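(* Let $n\geq 1$, let $S=\{(x_1,\dots,x_n,y_1,\dots,y_n)\in\mathbb{R}^{2n}: x_i+y_i>0 \text{ for all } 1\le i\le n\}$, and let $R\subset\mathbb{R}^{2n}$ be a finite union of real affine hyperplanes among which are the $n$ hyperplanes $\{X_i+Y_i=0\}$, $1\le i\le n$. Then the probabilistic communication complexity (over $\mathbb{R}$) of recognizing $S$ is greater than $n/2$, and the probabilistic communication complexity (over $\mathbb{R}$) of recognizing $R$ is greater than $n/2$.
   Context: Coordinates are $(X,Y)=(X_1,\dots,X_n,Y_1,\dots,Y_n)$. A (real) communication protocol is a finite rooted tree. To each non-leaf vertex $v$ is attached either a polynomial $a_v(X)\in\mathbb{R}[X]$ (computed by the first party) or $b_v(Y)\in\mathbb{R}[Y]$ (computed by the second party). If $q_1,\dots,q_r$ are the polynomials attached to the vertices on the path from the root to $v$ (including $v$), then $v$ carries finitely many testing polynomials $P_{v,j}\in\mathbb{R}[Q_1,\dots,Q_r]$, and on input $(x,y)$ the computation branches according to the signs ($<0,=0,>0$) of $P_{v,j}(q_1(x,y),\dots,q_r(x,y))$. Leaves are labelled "accept"/"reject". A probabilistic communication protocol is a finite family of such protocols $C_i$ chosen with probabilities $p_i\geq0$, $\sum p_i=1$, such that for every input the output correctly decides membership in the set with probability greater than $2/3$; its complexity is the maximal depth of the $C_i$, and the probabilistic communication complexity of a set is the minimum of this over probabilistic protocols recognizing it. *)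

theory Defs
  imports "HOL-Analysis.Analysis" "HOL-Library.Poly_Mapping"
begin

type_synonym 'v real_mpoly = "('v \<Rightarrow>\<^sub>0 nat) \<Rightarrow>\<^sub>0 real"

definition mpoly_eval :: "'v real_mpoly \<Rightarrow> ('v \<Rightarrow> real) \<Rightarrow> real" where
  "mpoly_eval p f =
     (\<Sum>m\<in>Poly_Mapping.keys p. Poly_Mapping.lookup p m *
        (\<Prod>v\<in>Poly_Mapping.keys m. f v ^ Poly_Mapping.lookup m v))"

definition mpoly_vars :: "'v real_mpoly \<Rightarrow> 'v set" where
  "mpoly_vars p = (\<Union>m\<in>Poly_Mapping.keys p. Poly_Mapping.keys m)"

datatype party = First | Second

text \<open>
  The dimension \<open>n\<close> is the cardinality of the finite index type \<open>'n\<close>; inputs are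
  pairs \<open>(x, y)\<close> in \<open>(real ^ 'n) \<times> (real ^ 'n)\<close>. A vertex \<open>Node w q Ps ch\<close> carries the polynomial
  \<open>q\<close>, read in the variables \<open>X\<close> if \<open>w = First\<close> and in the variables \<open>Y\<close> if \<open>w = Second\<close>, and
  the testing polynomials \<open>Ps\<close>, whose variable \<open>i\<close> (counted from 0) stands for the polynomial
  attached to the vertex at distance \<open>i\<close> from the root. The children of the vertex are the \<open>ch s\<close>
  with \<open>s\<close> in \<open>sign_vectors (length Ps)\<close>; the values of \<open>ch\<close> on other lists are not part of the
  tree and are ignored by all definitions below, so the tree is finite.
\<close>

datatype 'n protocol =
  Leaf bool
| Node party "'n real_mpoly" "nat real_mpoly list" "real list \<Rightarrow> 'n protocol"

definition sign_vectors :: "nat \<Rightarrow> real list set" where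
  "sign_vectors k = {s. length s = k \<and> set s \<subseteq> {-1, 0, 1}}"

text \<open>The argument \<open>r\<close> is the number of vertices strictly above the root of the subtree.\<close>

primrec wf_subprotocol :: "'n protocol \<Rightarrow> nat \<Rightarrow> bool" where
  "wf_subprotocol (Leaf b) r = True"
| "wf_subprotocol (Node w q Ps ch) r =
     ((\<forall>P\<in>set Ps. mpoly_vars P \<subseteq> {..<Suc r}) \<and>
      (\<forall>s\<in>sign_vectors (length Ps). wf_subprotocol (ch s) (Suc r)))"

definition wf_protocol :: "'n protocol \<Rightarrow> bool" where
  "wf_protocol C = wf_subprotocol C 0"

text \<open>Depth is the number of edges, equivalently of non-leaf vertices, on a longest branch.\<close>

primrec depth :: "'n protocol \<Rightarrow> nat" where
  "depth (Leaf b) = 0"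
| "depth (Node w q Ps ch) = Suc (Max ((\<lambda>s. depth (ch s)) ` sign_vectors (length Ps)))"

fun party_value :: "party \<Rightarrow> 'n::finite real_mpoly \<Rightarrow> (real ^ 'n) \<times> (real ^ 'n) \<Rightarrow> real" where
  "party_value First q (x, y) = mpoly_eval q (\<lambda>i. x $ i)"
| "party_value Second q (x, y) = mpoly_eval q (\<lambda>i. y $ i)"

text \<open>The list \<open>vs\<close> holds the values computed so far, in order from the root.\<close>

primrec run :: "'n::finite protocol \<Rightarrow> (real ^ 'n) \<times> (real ^ 'n) \<Rightarrow> real list \<Rightarrow> bool" where
  "run (Leaf b) z vs = b"
| "run (Node w q Ps ch) z vs =
     (let vs' = vs @ [party_value w q z]
      in run (ch (map (\<lambda>P. sgn (mpoly_eval P (\<lambda>i. vs' ! i))) Ps)) z vs')"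

definition accepts :: "'n::finite protocol \<Rightarrow> (real ^ 'n) \<times> (real ^ 'n) \<Rightarrow> bool" where
  "accepts C z = run C z []"

type_synonym 'n prob_protocol = "(real \<times> 'n protocol) list"

definition wf_prob_protocol :: "'n prob_protocol \<Rightarrow> bool" where
  "wf_prob_protocol F \<longleftrightarrow>
     (\<forall>(p, C)\<in>set F. p \<ge> 0 \<and> wf_protocol C) \<and> (\<Sum>(p, C)\<leftarrow>F. p) = 1"

definition correct_prob ::
  "'n::finite prob_protocol \<Rightarrow> ((real ^ 'n) \<times> (real ^ 'n)) set \<Rightarrow> (real ^ 'n) \<times> (real ^ 'n) \<Rightarrow> real" where
  "correct_prob F A z = (\<Sum>(p, C)\<leftarrow>F. if accepts C z \<longleftrightarrow> z \<in> A then p else 0)"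

definition recognizes :: "'n::finite prob_protocol \<Rightarrow> ((real ^ 'n) \<times> (real ^ 'n)) set \<Rightarrow> bool" where
  "recognizes F A \<longleftrightarrow> wf_prob_protocol F \<and> (\<forall>z. correct_prob F A z > 2 / 3)"

definition prob_depth :: "'n prob_protocol \<Rightarrow> nat" where
  "prob_depth F = Max ((\<lambda>(p, C). depth C) ` set F)"

text \<open>The minimum is \<open>\<infinity>\<close> if no probabilistic protocol recognizes the set.\<close>

definition prob_comm_complexity :: "((real ^ 'n::finite) \<times> (real ^ 'n)) set \<Rightarrow> enat" where
  "prob_comm_complexity A = (INF F\<in>{F. recognizes F A}. enat (prob_depth F))"

definition affine_hyperplane :: "'a::euclidean_space set \<Rightarrow> bool" where
  "affine_hyperplane H \<longleftrightarrow> (\<exists>a b. a \<noteq> 0 \<and> H = {z. a \<bullet> z = b})"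

end

theory Submission
  imports Defs "HOL-Computational_Algebra.Primes"
begin

text \<open>
  Put \<open>y = e - x\<close> with \<open>e\<^sub>i = p\<^sub>i\<^sup>-\<^sup>s\<close> for distinct primes \<open>p\<^sub>i\<close> and \<open>s \<rightarrow> \<infinity>\<close>. A polynomial
  \<open>f (x, y) = \<Sum>\<^sub>\<alpha> c\<^sub>\<alpha> (x) e\<^sup>\<alpha>\<close> becomes a Dirichlet polynomial, so by unique factorization the monomials have
  pairwise different orders of magnitude and the sign of \<open>f\<close> is that of the leading coefficient. Replacing
  \<open>e\<^sub>i\<close> by \<open>0\<close> can change this sign only if \<open>e\<^sub>i\<close> divides the leading monomial. In that case, let
  \<open>f = P (a (x), b (y))\<close> and let \<open>v\<close> be in the kernel of the derivative of \<open>a\<close> at \<open>x\<close>, with \<open>v\<^sub>j = 0\<close>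
  for \<open>p\<^sub>j > p\<^sub>i\<close>. Then \<open>f\<close> has derivative \<open>0\<close> in direction \<open>(v, 0)\<close>, and the leading term of this
  derivative is a nonzero multiple of \<open>v\<^sub>i\<close>, so \<open>v\<^sub>i = 0\<close>; likewise for \<open>b\<close>. By linear algebra, the number
  of such \<open>i\<close> along one branch is at most the number of polynomials of either party, hence at most half the
  depth. All other \<open>i\<close> give inputs that follow the same branch although membership differs. A protocol
  with error below \<open>1/3\<close> must distinguish each of these \<open>n\<close> inputs from the original one with
  probability above \<open>1/3\<close>, so its depth exceeds \<open>2 n / 3\<close>.
\<close>

section \<open>Expansions at the antidiagonal\<close>

definition mon :: "('n::finite \<Rightarrow> nat) \<Rightarrow> real ^ 'n \<Rightarrow> real" where
  "mon \<alpha> e = (\<Prod>i\<in>UNIV. e $ i ^ \<alpha> i)"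

text \<open>The product rule for the derivative of \<open>mon \<alpha>\<close> at \<open>e\<close>
  in direction \<open>v\<close>. If \<open>\<alpha> j = 0\<close>, the truncated exponent
  \<open>\<alpha> j - 1\<close> is harmless because the factor \<open>of_nat (\<alpha> j)\<close>
  kills the summand.\<close>

definition dmon :: "('n::finite \<Rightarrow> nat) \<Rightarrow> real ^ 'n \<Rightarrow> real ^ 'n \<Rightarrow> real" where
  "dmon \<alpha> e v = (\<Sum>j\<in>UNIV. (of_nat (\<alpha> j) * v $ j * e $ j ^ (\<alpha> j - 1)) * (\<Prod>i\<in>UNIV - {j}. e $ i ^ \<alpha> i))"

lemma mon_add: "mon (\<lambda>i. \<alpha> i + \<beta> i) e = mon \<alpha> e * mon \<beta> e"
  by (simp add: mon_def power_add prod.distrib)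

lemma mon_zero [simp]: "mon (\<lambda>i. 0) e = 1"
  by (simp add: mon_def)

lemma mon_single [simp]: "mon (\<lambda>j. if j = i then 1 else 0) e = e $ i"
proof -
  have "mon (\<lambda>j. if j = i then 1 else 0) e = (\<Prod>j\<in>UNIV. if j = i then e $ j else 1)"
    unfolding mon_def by (rule prod.cong) auto
  then show ?thesis by simp
qed

lemma has_derivative_mon:
  "((\<lambda>t. mon \<alpha> (e + t *\<^sub>R v)) has_real_derivative dmon \<alpha> e v) (at 0)"
proof -
  have "((\<lambda>t. (e $ i + t * v $ i) ^ \<alpha> i) has_real_derivative (of_nat (\<alpha> i) * v $ i * e $ i ^ (\<alpha> i - 1))) (at 0)" for i
    by (auto intro!: derivative_eq_intros)
  then have "((\<lambda>t. \<Prod>i\<in>UNIV. (e $ i + t * v $ i) ^ \<alpha> i) has_real_derivative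
    (\<Sum>j\<in>UNIV. (of_nat (\<alpha> j) * v $ j * e $ j ^ (\<alpha> j - 1)) * (\<Prod>i\<in>UNIV - {j}. (e $ i + 0 * v $ i) ^ \<alpha> i))) (at 0)"
    by (intro has_field_derivative_prod) auto
  then show ?thesis by (simp add: mon_def dmon_def)
qed

text \<open>\<open>F x e\<close> stands for a polynomial \<open>f\<close> at
  \<open>(x, e - x)\<close>, regarded as a polynomial in \<open>e\<close> only. The proof uses the
  signs, limits and first derivatives of the coefficients, so they are merely asked to be
  differentiable in \<open>x\<close>. Each exponent has a single coefficient, so that a leading term
  makes sense.\<close>

definition expandable :: "(real ^ 'n::finite \<Rightarrow> real ^ 'n \<Rightarrow> real) \<Rightarrow> bool" where
  "expandable F \<longleftrightarrow> (\<exists>A c. finite A \<and> (\<forall>\<alpha> x. c \<alpha> differentiable (at x)) \<and>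
     (\<forall>x e. F x e = (\<Sum>\<alpha>\<in>A. c \<alpha> x * mon \<alpha> e)))"

text \<open>Collecting the terms with equal exponent turns any finite family into an expansion. Sums
  and products of expansions produce such repeated exponents.\<close>

lemma expandable_family:
  assumes fin: "finite T" and diff: "\<And>t x. t \<in> T \<Longrightarrow> c t differentiable (at x)"
    and F: "\<And>x e. F x e = (\<Sum>t\<in>T. c t x * mon (a t) e)"
  shows "expandable F"
  unfolding expandable_def
proof (intro exI conjI allI)
  let ?c = "\<lambda>\<alpha> x. \<Sum>t\<in>{t. t \<in> T \<and> a t = \<alpha>}. c t x"
  show "finite (a ` T)" using fin by simp
  show "?c \<alpha> differentiable (at x)" for \<alpha> x
    using fin diff by (intro differentiable_sum) auto
  show "F x e = (\<Sum>\<alpha>\<in>a ` T. ?c \<alpha> x * mon \<alpha> e)" for x e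
    unfolding F sum.image_gen[OF fin, of _ a] by (auto simp: sum_distrib_right intro!: sum.cong)
qed

lemma expandable_coeff:
  assumes "\<And>x. c differentiable (at x)" shows "expandable (\<lambda>x e. c x)"
  by (rule expandable_family[where T = "{()}" and c = "\<lambda>_. c" and a = "\<lambda>_ _. 0"]) (use assms in auto)

lemma expandable_const: "expandable (\<lambda>x e. k)"
  by (rule expandable_coeff) simp

lemma expandable_fst: "expandable (\<lambda>x e. x $ i)"
  by (rule expandable_coeff) (simp add: bounded_linear_imp_differentiable bounded_linear_vec_nth)

lemma expandable_snd: "expandable (\<lambda>x e. e $ i)"
  by (rule expandable_family[where T = "{()}" and c = "\<lambda>_ _. 1" and a = "\<lambda>_ j. if j = i then 1 else 0"]) auto

lemma expandable_add:
  assumes "expandable F" "expandable G" shows "expandable (\<lambda>x e. F x e + G x e)"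
proof -
  obtain A c where A: "finite A" "\<And>\<alpha> x. c \<alpha> differentiable (at x)"
    "\<And>x e. F x e = (\<Sum>\<alpha>\<in>A. c \<alpha> x * mon \<alpha> e)" using assms(1) unfolding expandable_def by metis
  obtain B d where B: "finite B" "\<And>\<alpha> x. d \<alpha> differentiable (at x)"
    "\<And>x e. G x e = (\<Sum>\<alpha>\<in>B. d \<alpha> x * mon \<alpha> e)" using assms(2) unfolding expandable_def by metis
  show ?thesis
    by (rule expandable_family[where T = "A <+> B" and c = "case_sum c d" and a = "case_sum id id"])
      (use A B in \<open>auto simp: sum.Plus\<close>)
qed

lemma expandable_mult:
  assumes "expandable F" "expandable G" shows "expandable (\<lambda>x e. F x e * G x e)"
proof -
  obtain A c where A: "finite A" "\<And>\<alpha> x. c \<alpha> differentiable (at x)"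
    "\<And>x e. F x e = (\<Sum>\<alpha>\<in>A. c \<alpha> x * mon \<alpha> e)" using assms(1) unfolding expandable_def by metis
  obtain B d where B: "finite B" "\<And>\<alpha> x. d \<alpha> differentiable (at x)"
    "\<And>x e. G x e = (\<Sum>\<alpha>\<in>B. d \<alpha> x * mon \<alpha> e)" using assms(2) unfolding expandable_def by metis
  show ?thesis
  proof (rule expandable_family[where T = "A \<times> B" and c = "\<lambda>(\<alpha>, \<beta>) x. c \<alpha> x * d \<beta> x"
        and a = "\<lambda>(\<alpha>, \<beta>) i. \<alpha> i + \<beta> i"])
    show "F x e * G x e = (\<Sum>t\<in>A \<times> B. (case t of (\<alpha>, \<beta>) \<Rightarrow> \<lambda>x. c \<alpha> x * d \<beta> x) x *
           mon ((case t of (\<alpha>, \<beta>) \<Rightarrow> \<lambda>i. \<alpha> i + \<beta> i)) e)" for x e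
      unfolding A(3) B(3) sum_product sum.cartesian_product
      by (rule sum.cong) (auto simp: mon_add)
  qed (use A B in auto)
qed

lemma expandable_sum:
  assumes "\<And>t. t \<in> T \<Longrightarrow> expandable (F t)" shows "expandable (\<lambda>x e. \<Sum>t\<in>T. F t x e)"
  using assms by (induction T rule: infinite_finite_induct) (auto intro: expandable_add expandable_const)

lemma expandable_prod:
  assumes "\<And>t. t \<in> T \<Longrightarrow> expandable (F t)" shows "expandable (\<lambda>x e. \<Prod>t\<in>T. F t x e)"
  using assms by (induction T rule: infinite_finite_induct) (auto intro: expandable_mult expandable_const)

lemma expandable_power:
  assumes "expandable F" shows "expandable (\<lambda>x e. F x e ^ k)"
  by (induction k) (auto intro: expandable_mult expandable_const assms)

lemma expandable_diff:
  assumes "expandable F" "expandable G" shows "expandable (\<lambda>x e. F x e - G x e)"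
  using expandable_add[OF assms(1) expandable_mult[OF expandable_const[of "-1"] assms(2)]] by simp

lemma expandable_mpoly_eval:
  assumes "\<And>v. v \<in> mpoly_vars q \<Longrightarrow> expandable (g v)"
  shows "expandable (\<lambda>x e. mpoly_eval q (\<lambda>v. g v x e))"
  unfolding mpoly_eval_def
  by (intro expandable_sum expandable_mult expandable_const expandable_prod expandable_power assms)
    (auto simp: mpoly_vars_def)

lemma expandable_party_value: "expandable (\<lambda>x e. party_value w q (x, e - x))"
  by (cases w) (auto intro!: expandable_mpoly_eval expandable_fst expandable_diff expandable_snd)

text \<open>A case of the chain rule: every summand of the derivative contains the derivative of
  some \<open>g v\<close> as a factor.\<close>

lemma mpoly_eval_deriv_zero:
  assumes "\<And>v. v \<in> mpoly_vars q \<Longrightarrow> ((\<lambda>t. g v t) has_real_derivative 0) (at 0)"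
  shows "((\<lambda>t. mpoly_eval q (\<lambda>v. g v t)) has_real_derivative 0) (at 0)"
proof -
  have *: "((\<lambda>t. Poly_Mapping.lookup q m * (\<Prod>v\<in>Poly_Mapping.keys m. g v t ^ Poly_Mapping.lookup m v)) has_real_derivative 0) (at 0)"
    if "m \<in> Poly_Mapping.keys q" for m
  proof -
    have "((\<lambda>t. g v t ^ Poly_Mapping.lookup m v) has_real_derivative 0) (at 0)" if "v \<in> Poly_Mapping.keys m" for v
    proof -
      have "((\<lambda>t. g v t) has_real_derivative 0) (at 0)"
        using assms that \<open>m \<in> Poly_Mapping.keys q\<close> by (auto simp: mpoly_vars_def)
      from DERIV_power[OF this, of "Poly_Mapping.lookup m v"] show ?thesis by simp
    qed
    then have "((\<lambda>t. \<Prod>v\<in>Poly_Mapping.keys m. g v t ^ Poly_Mapping.lookup m v) has_real_derivative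
       (\<Sum>v\<in>Poly_Mapping.keys m. 0 * (\<Prod>u\<in>Poly_Mapping.keys m - {v}. g u 0 ^ Poly_Mapping.lookup m u))) (at 0)"
      by (intro has_field_derivative_prod) auto
    from DERIV_cmult[OF this, of "Poly_Mapping.lookup q m"] show ?thesis by simp
  qed
  have "((\<lambda>t. \<Sum>m\<in>Poly_Mapping.keys q. Poly_Mapping.lookup q m * (\<Prod>v\<in>Poly_Mapping.keys m. g v t ^ Poly_Mapping.lookup m v)) has_real_derivative (\<Sum>m\<in>Poly_Mapping.keys q. 0)) (at 0)"
    using * by (intro DERIV_sum) auto
  then show ?thesis unfolding mpoly_eval_def by simp
qed

lemma expandable_differentiable:
  assumes "expandable F" shows "(\<lambda>x. F x e) differentiable (at x)"
proof -
  obtain A c where "finite A" "\<And>\<alpha> x. c \<alpha> differentiable (at x)"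
    "\<And>x e. F x e = (\<Sum>\<alpha>\<in>A. c \<alpha> x * mon \<alpha> e)" using assms unfolding expandable_def by metis
  then show ?thesis by simp
qed

section \<open>Shrinking open sets\<close>

text \<open>Either \<open>c\<close> is nonzero at a point of \<open>U\<close>, and by continuity
  keeps its sign nearby, or \<open>c\<close> vanishes on all of \<open>U\<close>. This replaces a
  choice of generic points.\<close>

lemma constant_sign_open_subset:
  fixes c :: "'a::topological_space \<Rightarrow> real"
  assumes "continuous_on UNIV c" "open U" "U \<noteq> {}"
  shows "\<exists>V\<subseteq>U. open V \<and> V \<noteq> {} \<and> (\<exists>\<sigma>. \<forall>x\<in>V. sgn (c x) = \<sigma>)"
proof -
  have op: "open {x. c x > 0}" "open {x. c x < 0}"
    using assms(1) by (auto intro!: open_Collect_less)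
  consider "\<exists>x\<in>U. c x > 0" | "\<exists>x\<in>U. c x < 0" | "\<forall>x\<in>U. c x = 0" by force
  then show ?thesis
  proof cases
    case 1
    then show ?thesis using op assms by (intro exI[of _ "U \<inter> {x. c x > 0}"]) auto
  next
    case 2
    then show ?thesis using op assms by (intro exI[of _ "U \<inter> {x. c x < 0}"]) auto
  next
    case 3
    then show ?thesis using assms by (intro exI[of _ U]) auto
  qed
qed

text \<open>The conditions are met one after the other; \<open>mono\<close> preserves those already
  met when the open set shrinks further.\<close>

lemma finite_shrink:
  assumes "finite A"
    and step: "\<And>a U. a \<in> A \<Longrightarrow> open U \<Longrightarrow> U \<noteq> {} \<Longrightarrow> \<exists>V\<subseteq>U. open V \<and> V \<noteq> {} \<and> Q a V"
    and mono: "\<And>a V W. Q a V \<Longrightarrow> W \<subseteq> V \<Longrightarrow> Q a W"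
    and "open U" "U \<noteq> {}"
  shows "\<exists>V\<subseteq>U. open V \<and> V \<noteq> {} \<and> (\<forall>a\<in>A. Q a V)"
  using assms(1) step
proof (induction A rule: finite_induct)
  case empty
  then show ?case using assms by auto
next
  case (insert a A)
  then obtain V where V: "V \<subseteq> U" "open V" "V \<noteq> {}" "\<forall>a\<in>A. Q a V" by (metis insertCI)
  with insert.prems[of a V] obtain W where W: "W \<subseteq> V" "open W" "W \<noteq> {}" "Q a W" by auto
  then show ?case using V mono by (intro exI[of _ W]) blast
qed

section \<open>Infinitesimal points\<close>

locale prime_weights =
  fixes p :: "'n::finite \<Rightarrow> nat"
  assumes inj_p: "inj p" and prime_p: "\<And>i. prime (p i)"
begin

text \<open>The order of magnitude of a monomial: at \<open>eps s\<close> it equals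
  \<open>(1 / weight \<alpha>) ^ s\<close>, so smaller weight means larger monomial.\<close>

definition weight :: "('n \<Rightarrow> nat) \<Rightarrow> real" where
  "weight \<alpha> = (\<Prod>i\<in>UNIV. real (p i) ^ \<alpha> i)"

definition eps :: "nat \<Rightarrow> real ^ 'n" where
  "eps s = (\<chi> i. (1 / real (p i)) ^ s)"

text \<open>With this vector as \<open>e\<close>, the input \<open>(x, e - x)\<close> lies exactly
  on the hyperplane where the coordinates \<open>i\<close> of both parts sum to 0.\<close>

definition eps_without :: "'n \<Rightarrow> nat \<Rightarrow> real ^ 'n" where
  "eps_without i s = (\<chi> j. if j = i then 0 else (1 / real (p j)) ^ s)"

lemma p_ge_2: "real (p i) \<ge> 2"
  using prime_ge_2_nat[OF prime_p[of i]] by simp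

lemma p_gt_0 [simp]: "p i > 0"
  using prime_gt_0_nat[OF prime_p] .

lemma weight_pos: "weight \<alpha> > 0"
  unfolding weight_def by (intro prod_pos) simp

text \<open>Unique factorization: the exponent \<open>\<alpha> j\<close> is the multiplicity of
  \<open>p j\<close> in the weight. Hence no two monomials have the same order of magnitude.\<close>

lemma weight_inj: assumes "weight \<alpha> = weight \<beta>" shows "\<alpha> = \<beta>"
proof -
  have mult: "multiplicity (p j) (\<Prod>i\<in>UNIV. p i ^ \<alpha> i) = \<alpha> j" for \<alpha> :: "'n \<Rightarrow> nat" and j
  proof -
    \<comment> \<open>The library fact on multiplicities concerns products over a set of primes, so
      the product is reindexed from indices to the primes themselves.\<close>
    have "(\<Prod>i\<in>UNIV. p i ^ \<alpha> i) = (\<Prod>q\<in>range p. q ^ \<alpha> (inv p q))"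
      using inj_p by (simp add: prod.reindex)
    also have "multiplicity (p j) \<dots> = \<alpha> j"
      using inj_p prime_p by (subst multiplicity_prod_prime_powers) auto
    finally show ?thesis .
  qed
  have "real (\<Prod>i\<in>UNIV. p i ^ \<alpha> i) = real (\<Prod>i\<in>UNIV. p i ^ \<beta> i)"
    using assms by (simp add: weight_def)
  then have "(\<Prod>i\<in>UNIV. p i ^ \<alpha> i) = (\<Prod>i\<in>UNIV. p i ^ \<beta> i)" by linarith
  then show ?thesis using mult by (metis ext)
qed

lemma mon_eps: "mon \<alpha> (eps s) = (1 / weight \<alpha>) ^ s"
  by (simp add: mon_def eps_def weight_def power_divide prod_dividef prod_power_distrib mult.commute
      flip: power_mult)

lemma mon_eps_without: "mon \<alpha> (eps_without i s) = (if \<alpha> i = 0 then (1 / weight \<alpha>) ^ s else 0)"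
proof (cases "\<alpha> i = 0")
  case True
  have "mon \<alpha> (eps_without i s) = mon \<alpha> (eps s)"
    unfolding mon_def by (rule prod.cong) (auto simp: eps_without_def eps_def True)
  then show ?thesis using True mon_eps by simp
next
  case False
  then show ?thesis by (auto simp: mon_def eps_without_def)
qed

text \<open>Differentiating with respect to coordinate \<open>j\<close> removes one factor
  \<open>e $ j\<close>, which at \<open>eps s\<close> means multiplication by
  \<open>real (p j) ^ s\<close>.\<close>

lemma dmon_eps:
  "dmon \<alpha> (eps s) v = (\<Sum>j\<in>UNIV. of_nat (\<alpha> j) * v $ j * (real (p j) / weight \<alpha>) ^ s)"
  unfolding dmon_def
proof (rule sum.cong)
  fix j
  show "(of_nat (\<alpha> j) * v $ j * eps s $ j ^ (\<alpha> j - 1)) * (\<Prod>i\<in>UNIV - {j}. eps s $ i ^ \<alpha> i)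
      = of_nat (\<alpha> j) * v $ j * (real (p j) / weight \<alpha>) ^ s"
  proof (cases "\<alpha> j = 0")
    case False
    let ?R = "\<Prod>i\<in>UNIV - {j}. eps s $ i ^ \<alpha> i"
    have "(1 / weight \<alpha>) ^ s = eps s $ j ^ \<alpha> j * ?R"
      unfolding mon_eps[symmetric] mon_def by (rule prod.remove) auto
    also have "eps s $ j ^ \<alpha> j = eps s $ j * eps s $ j ^ (\<alpha> j - 1)"
      using False by (simp add: power_eq_if)
    finally have *: "(1 / weight \<alpha>) ^ s = eps s $ j * eps s $ j ^ (\<alpha> j - 1) * ?R" .
    have "(real (p j) / weight \<alpha>) ^ s = real (p j) ^ s * (1 / weight \<alpha>) ^ s"
      by (simp add: power_divide)
    also have "\<dots> = (real (p j) ^ s * eps s $ j) * (eps s $ j ^ (\<alpha> j - 1) * ?R)"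
      unfolding * by (simp only: mult_ac)
    also have "real (p j) ^ s * eps s $ j = 1"
      using p_gt_0[of j] by (simp add: eps_def power_divide)
    finally show ?thesis by simp
  qed simp
qed simp

lemma eps_tendsto_0: "eps \<longlonglongrightarrow> 0"
proof (rule vec_tendstoI)
  fix i
  have "(\<lambda>s. (1 / real (p i)) ^ s) \<longlonglongrightarrow> 0"
    using p_ge_2[of i] by (intro LIMSEQ_power_zero) auto
  then show "(\<lambda>s. eps s $ i) \<longlonglongrightarrow> 0 $ i" by (simp add: eps_def)
qed

section \<open>Leading terms of Dirichlet polynomials\<close>

lemma leading_term_limit:
  assumes "finite B" "\<alpha>0 \<in> B" and min: "\<And>\<alpha>. \<alpha> \<in> B \<Longrightarrow> \<alpha> \<noteq> \<alpha>0 \<Longrightarrow> weight \<alpha>0 < weight \<alpha>"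
  shows "(\<lambda>s. weight \<alpha>0 ^ s * (\<Sum>\<alpha>\<in>B. c \<alpha> * (1 / weight \<alpha>) ^ s)) \<longlonglongrightarrow> c \<alpha>0"
proof -
  have "(\<lambda>s. c \<alpha> * (weight \<alpha>0 / weight \<alpha>) ^ s) \<longlonglongrightarrow> (if \<alpha> = \<alpha>0 then c \<alpha>0 else 0)" if "\<alpha> \<in> B" for \<alpha>
  proof (cases "\<alpha> = \<alpha>0")
    case True
    then show ?thesis using weight_pos[of \<alpha>] by simp
  next
    case False
    with min[OF that False] weight_pos[of \<alpha>0] weight_pos[of \<alpha>]
    have "(\<lambda>s. (weight \<alpha>0 / weight \<alpha>) ^ s) \<longlonglongrightarrow> 0" by (intro LIMSEQ_power_zero) auto
    from tendsto_mult_right_zero[OF this] False show ?thesis by simp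
  qed
  then have "(\<lambda>s. \<Sum>\<alpha>\<in>B. c \<alpha> * (weight \<alpha>0 / weight \<alpha>) ^ s) \<longlonglongrightarrow> (\<Sum>\<alpha>\<in>B. if \<alpha> = \<alpha>0 then c \<alpha>0 else 0)"
    by (intro tendsto_sum)
  then show ?thesis using assms by (simp add: sum_distrib_left power_divide mult_ac)
qed

lemma eventually_leading_sign:
  assumes "finite B" "\<alpha>0 \<in> B" and min: "\<And>\<alpha>. \<alpha> \<in> B \<Longrightarrow> \<alpha> \<noteq> \<alpha>0 \<Longrightarrow> weight \<alpha>0 < weight \<alpha>"
    and nz: "c \<alpha>0 \<noteq> 0"
  shows "\<forall>\<^sub>F s in sequentially. sgn (\<Sum>\<alpha>\<in>B. c \<alpha> * (1 / weight \<alpha>) ^ s) = sgn (c \<alpha>0)"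
proof -
  let ?g = "\<lambda>s. weight \<alpha>0 ^ s * (\<Sum>\<alpha>\<in>B. c \<alpha> * (1 / weight \<alpha>) ^ s)"
  have lim: "?g \<longlonglongrightarrow> c \<alpha>0" by (rule leading_term_limit[OF assms(1-3)])
  have "\<forall>\<^sub>F s in sequentially. sgn (?g s) = sgn (c \<alpha>0)"
  proof (cases "c \<alpha>0 > 0")
    case True
    from order_tendstoD(1)[OF lim True] show ?thesis by eventually_elim (use True in auto)
  next
    case False
    with nz have "c \<alpha>0 < 0" by simp
    from order_tendstoD(2)[OF lim this] show ?thesis by eventually_elim (use \<open>c \<alpha>0 < 0\<close> in auto)
  qed
  then show ?thesis by eventually_elim (use weight_pos[of \<alpha>0] in \<open>simp add: sgn_mult\<close>)
qed

text \<open>The derivative is scaled by the inverse of its expected order, that of the leading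
  monomial divided by \<open>e $ i\<close>. Only the term with \<open>\<alpha> = \<alpha>0\<close>
  and \<open>j = i\<close> survives in the limit, and the limit is 0. The numbers
  \<open>d \<alpha>\<close> are derivatives of the coefficients. The coefficients themselves are
  sequences \<open>C \<alpha>\<close>, since they are evaluated at \<open>x\<close> for one party
  but at \<open>x + eps s\<close> for the other.\<close>

lemma leading_derivative_vanishes:
  assumes fin: "finite B" and \<alpha>0: "\<alpha>0 \<in> B"
    and min: "\<And>\<alpha>. \<alpha> \<in> B \<Longrightarrow> \<alpha> \<noteq> \<alpha>0 \<Longrightarrow> weight \<alpha>0 < weight \<alpha>"
    and v: "\<And>j. p j > p i \<Longrightarrow> v $ j = 0"
    and i: "\<alpha>0 i > 0"
    and C: "\<And>\<alpha>. \<alpha> \<in> B \<Longrightarrow> C \<alpha> \<longlonglongrightarrow> c \<alpha>" and nz: "c \<alpha>0 \<noteq> 0"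
    and ev: "\<forall>\<^sub>F s in sequentially. (\<Sum>\<alpha>\<in>B. d \<alpha> * mon \<alpha> (eps s) + dmon \<alpha> (eps s) v * C \<alpha> s) = 0"
  shows "v $ i = 0"
proof -
  define r where "r = weight \<alpha>0 / real (p i)"
  have r: "r > 0" unfolding r_def using weight_pos[of \<alpha>0] by simp
  have le: "weight \<alpha>0 \<le> weight \<alpha>" if "\<alpha> \<in> B" for \<alpha> using min[OF that] by fastforce
  \<comment> \<open>Differentiating a coefficient leaves the monomial intact, so these terms are
    smaller than the scale by a factor of at least \<open>p i ^ s\<close>.\<close>
  have lim1: "(\<lambda>s. d \<alpha> * (r / weight \<alpha>) ^ s) \<longlonglongrightarrow> 0" if "\<alpha> \<in> B" for \<alpha>
  proof -
    have "weight \<alpha> * 1 < weight \<alpha> * real (p i)"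
      using weight_pos[of \<alpha>] p_ge_2[of i] by (intro mult_strict_left_mono) auto
    then have "weight \<alpha>0 < weight \<alpha> * real (p i)"
      using le[OF that] by linarith
    then have "r / weight \<alpha> < 1"
      using weight_pos[of \<alpha>] p_gt_0[of i] by (simp add: r_def field_simps)
    then have "(\<lambda>s. (r / weight \<alpha>) ^ s) \<longlonglongrightarrow> 0"
      using r weight_pos[of \<alpha>] by (intro LIMSEQ_power_zero) auto
    then show ?thesis by (rule tendsto_mult_right_zero)
  qed
  have lim2: "(\<lambda>s. of_nat (\<alpha> j) * v $ j * (r * real (p j) / weight \<alpha>) ^ s * C \<alpha> s)
     \<longlonglongrightarrow> (if j = i then (if \<alpha> = \<alpha>0 then of_nat (\<alpha>0 i) * v $ i * c \<alpha>0 else 0) else 0)"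
    if "\<alpha> \<in> B" for \<alpha> j
  proof -
    \<comment> \<open>The base \<open>r * real (p j) / weight \<alpha>\<close> is the product of
      \<open>weight \<alpha>0 / weight \<alpha>\<close> and \<open>p j / p i\<close>. Where
      \<open>v $ j\<close> is nonzero, both factors are at most 1, and both equal 1 only in the
      first case.\<close>
    consider "\<alpha> = \<alpha>0" "j = i" | "v $ j = 0" "\<not> (\<alpha> = \<alpha>0 \<and> j = i)" | "p j \<le> p i" "\<not> (\<alpha> = \<alpha>0 \<and> j = i)"
      using v[of j] by linarith
    then show ?thesis
    proof cases
      case 1
      then have "r * real (p j) / weight \<alpha> = 1"
        using weight_pos[of \<alpha>0] p_gt_0[of i] by (simp add: r_def)
      then show ?thesis using 1 C[OF that] by (auto intro!: tendsto_intros)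
    next
      case 2
      then show ?thesis by auto
    next
      case 3
      have "weight \<alpha>0 * real (p j) < weight \<alpha> * real (p i)"
      proof (cases "\<alpha> = \<alpha>0")
        case True
        then have "p j \<noteq> p i" using 3 inj_p by (auto dest: injD)
        then show ?thesis using True 3 weight_pos[of \<alpha>0] by simp
      next
        case False
        have "weight \<alpha>0 * real (p j) \<le> weight \<alpha>0 * real (p i)"
          using 3 weight_pos[of \<alpha>0] by simp
        also have "\<dots> < weight \<alpha> * real (p i)" using min[OF that False] by simp
        finally show ?thesis .
      qed
      then have "r * real (p j) / weight \<alpha> < 1"
        using weight_pos[of \<alpha>] p_gt_0[of i] by (simp add: r_def field_simps)
      moreover have "r * real (p j) / weight \<alpha> \<ge> 0" using r weight_pos[of \<alpha>] by simp
      ultimately have "(\<lambda>s. (r * real (p j) / weight \<alpha>) ^ s) \<longlonglongrightarrow> 0"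
        by (intro LIMSEQ_power_zero) (simp only: real_norm_def abs_of_nonneg)
      then have "(\<lambda>s. of_nat (\<alpha> j) * v $ j * (r * real (p j) / weight \<alpha>) ^ s * C \<alpha> s)
           \<longlonglongrightarrow> of_nat (\<alpha> j) * v $ j * 0 * c \<alpha>"
        using C[OF that] by (intro tendsto_mult tendsto_const)
      then show ?thesis using 3 by auto
    qed
  qed
  have "(\<lambda>s. \<Sum>\<alpha>\<in>B. d \<alpha> * (r / weight \<alpha>) ^ s +
           (\<Sum>j\<in>UNIV. of_nat (\<alpha> j) * v $ j * (r * real (p j) / weight \<alpha>) ^ s * C \<alpha> s))
      \<longlonglongrightarrow> (\<Sum>\<alpha>\<in>B. 0 + (\<Sum>j\<in>UNIV. if j = i then (if \<alpha> = \<alpha>0 then of_nat (\<alpha>0 i) * v $ i * c \<alpha>0 else 0) else 0))"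
    by (intro tendsto_sum tendsto_add lim1 lim2)
  also have "(\<Sum>\<alpha>\<in>B. 0 + (\<Sum>j\<in>UNIV. if j = i then (if \<alpha> = \<alpha>0 then of_nat (\<alpha>0 i) * v $ i * c \<alpha>0 else 0) else 0))
      = of_nat (\<alpha>0 i) * v $ i * c \<alpha>0"
    using fin \<alpha>0 by simp
  also have "(\<lambda>s. \<Sum>\<alpha>\<in>B. d \<alpha> * (r / weight \<alpha>) ^ s +
           (\<Sum>j\<in>UNIV. of_nat (\<alpha> j) * v $ j * (r * real (p j) / weight \<alpha>) ^ s * C \<alpha> s))
      = (\<lambda>s. r ^ s * (\<Sum>\<alpha>\<in>B. d \<alpha> * mon \<alpha> (eps s) + dmon \<alpha> (eps s) v * C \<alpha> s))"
    by (simp add: mon_eps dmon_eps sum_distrib_left sum_distrib_right ring_distribs power_divide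
        power_mult_distrib mult_ac)
  finally have "(\<lambda>s. r ^ s * (\<Sum>\<alpha>\<in>B. d \<alpha> * mon \<alpha> (eps s) + dmon \<alpha> (eps s) v * C \<alpha> s))
     \<longlonglongrightarrow> of_nat (\<alpha>0 i) * v $ i * c \<alpha>0" .
  moreover have "(\<lambda>s. r ^ s * (\<Sum>\<alpha>\<in>B. d \<alpha> * mon \<alpha> (eps s) + dmon \<alpha> (eps s) v * C \<alpha> s)) \<longlonglongrightarrow> 0"
    by (rule tendsto_eventually, use ev in eventually_elim) simp
  ultimately have "of_nat (\<alpha>0 i) * v $ i * c \<alpha>0 = 0" by (rule LIMSEQ_unique)
  then show ?thesis using i nz by simp
qed


text \<open>With \<open>f (x, y) = F x (x + y)\<close>, the two directional derivatives are those of \<open>f\<close> at \<open>(x, e - x)\<close>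
  in direction \<open>(v, 0)\<close> and at \<open>(x + e, - x)\<close> in direction \<open>(0, v)\<close>.\<close>

definition separates :: "(real ^ 'n \<Rightarrow> real ^ 'n \<Rightarrow> real) \<Rightarrow> real ^ 'n \<Rightarrow> 'n \<Rightarrow> bool" where
  "separates F x i \<longleftrightarrow> (\<forall>v. (\<forall>j. p j > p i \<longrightarrow> v $ j = 0) \<longrightarrow>
     (\<forall>e. ((\<lambda>t. F (x + t *\<^sub>R v) (e + t *\<^sub>R v)) has_real_derivative 0) (at 0)) \<or>
     (\<forall>e. ((\<lambda>t. F (x + e) (e + t *\<^sub>R v)) has_real_derivative 0) (at 0)) \<longrightarrow> v $ i = 0)"

text \<open>On a small open set all coefficients have constant sign, and the leading monomial
  decides the sign at \<open>eps s\<close>. If \<open>e $ i\<close> does not divide it, it survives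
  setting \<open>e $ i\<close> to 0; if it does, \<open>leading_derivative_vanishes\<close> yields
  \<open>separates\<close>. The clause for \<open>\<sigma> = 0\<close> serves the avoidance of
  hyperplanes.\<close>

lemma expandable_sign:
  assumes F: "expandable F" and U: "open U" "U \<noteq> {}"
  shows "\<exists>V\<subseteq>U. open V \<and> V \<noteq> {} \<and> (\<exists>\<sigma>. (\<sigma> = 0 \<longrightarrow> (\<forall>x\<in>V. \<forall>e. F x e = 0)) \<and>
    (\<forall>x\<in>V. (\<forall>\<^sub>F s in sequentially. sgn (F x (eps s)) = \<sigma>) \<and>
      (\<forall>i. separates F x i \<or> (\<forall>\<^sub>F s in sequentially. sgn (F x (eps_without i s)) = \<sigma>))))"
proof -
  obtain A c where A: "finite A" and diff: "\<And>\<alpha> x. c \<alpha> differentiable (at x)"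
    and Feq: "\<And>x e. F x e = (\<Sum>\<alpha>\<in>A. c \<alpha> x * mon \<alpha> e)" using F unfolding expandable_def by metis
  have cont: "continuous_on UNIV (c \<alpha>)" for \<alpha>
    using diff by (auto simp: continuous_on_eq_continuous_at intro: differentiable_imp_continuous_within)
  obtain V where V: "V \<subseteq> U" "open V" "V \<noteq> {}" "\<forall>\<alpha>\<in>A. \<exists>\<sigma>. \<forall>x\<in>V. sgn (c \<alpha> x) = \<sigma>"
    using finite_shrink[of A "\<lambda>\<alpha> V. \<exists>\<sigma>. \<forall>x\<in>V. sgn (c \<alpha> x) = \<sigma>" U, OF A constant_sign_open_subset[OF cont]] U
    by blast
  then obtain \<sigma> where \<sigma>: "\<And>\<alpha> x. \<alpha> \<in> A \<Longrightarrow> x \<in> V \<Longrightarrow> sgn (c \<alpha> x) = \<sigma> \<alpha>" by metis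
  \<comment> \<open>The exponents whose coefficients have no zero on \<open>V\<close>; the other
    coefficients vanish identically there.\<close>
  define B where "B = {\<alpha>\<in>A. \<sigma> \<alpha> \<noteq> 0}"
  have B: "finite B" unfolding B_def using A by simp
  have "c \<alpha> x = 0" if "\<alpha> \<in> A" "\<alpha> \<notin> B" "x \<in> V" for \<alpha> x
    using \<sigma>[of \<alpha> x] that by (simp add: B_def sgn_zero_iff)
  then have FB: "F x e = (\<Sum>\<alpha>\<in>B. c \<alpha> x * mon \<alpha> e)" if "x \<in> V" for x e
    unfolding Feq using A that by (intro sum.mono_neutral_right) (auto simp: B_def)
  show ?thesis
  proof (cases "B = {}")
    case True
    then show ?thesis using V FB by (intro exI[of _ V] conjI exI[of _ 0]) auto
  next
    case False
    define \<alpha>0 where "\<alpha>0 = arg_min_on weight B"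
    have \<alpha>0: "\<alpha>0 \<in> B" unfolding \<alpha>0_def by (rule arg_min_if_finite[OF B False])
    have min: "weight \<alpha>0 < weight \<alpha>" if "\<alpha> \<in> B" "\<alpha> \<noteq> \<alpha>0" for \<alpha>
      using arg_min_least[OF B False, of \<alpha> weight] that weight_inj[of \<alpha> \<alpha>0] unfolding \<alpha>0_def by force
    have sgn0: "sgn (c \<alpha>0 x) = \<sigma> \<alpha>0" "c \<alpha>0 x \<noteq> 0" if "x \<in> V" for x
      using \<alpha>0 \<sigma>[OF _ that, of \<alpha>0] by (auto simp: B_def)
    have ev: "\<forall>\<^sub>F s in sequentially. sgn (F x (eps s)) = \<sigma> \<alpha>0" if x: "x \<in> V" for x
      using eventually_leading_sign[OF B \<alpha>0 min, of "\<lambda>\<alpha>. c \<alpha> x"] sgn0[OF x] by (simp add: FB[OF x] mon_eps)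
    have evi: "\<forall>\<^sub>F s in sequentially. sgn (F x (eps_without i s)) = \<sigma> \<alpha>0" if x: "x \<in> V" and i: "\<alpha>0 i = 0" for x i
    proof -
      \<comment> \<open>Setting \<open>e $ i\<close> to 0 amounts to deleting the coefficients of
        all monomials divisible by it, so \<open>\<alpha>0\<close> remains the exponent of least
        weight.\<close>
      have "F x (eps_without i s) = (\<Sum>\<alpha>\<in>B. (if \<alpha> i = 0 then c \<alpha> x else 0) * (1 / weight \<alpha>) ^ s)" for s
        unfolding FB[OF x] mon_eps_without by (rule sum.cong) auto
      then show ?thesis
        using eventually_leading_sign[OF B \<alpha>0 min, of "\<lambda>\<alpha>. if \<alpha> i = 0 then c \<alpha> x else 0"] sgn0[OF x] i by simp
    qed
    have sep: "separates F x i" if x: "x \<in> V" and i: "\<alpha>0 i > 0" for x i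
      unfolding separates_def
    proof (intro allI impI)
      fix v :: "real ^ 'n"
      assume v: "\<forall>j. p j > p i \<longrightarrow> v $ j = 0"
      assume "(\<forall>e. ((\<lambda>t. F (x + t *\<^sub>R v) (e + t *\<^sub>R v)) has_real_derivative 0) (at 0)) \<or>
         (\<forall>e. ((\<lambda>t. F (x + e) (e + t *\<^sub>R v)) has_real_derivative 0) (at 0))"
      then show "v $ i = 0"
      proof
        assume zero: "\<forall>e. ((\<lambda>t. F (x + t *\<^sub>R v) (e + t *\<^sub>R v)) has_real_derivative 0) (at 0)"
        have "\<exists>D. ((\<lambda>t. c \<alpha> (x + t *\<^sub>R v)) has_real_derivative D) (at 0)" for \<alpha>
        proof -
          obtain L where L: "(c \<alpha> has_derivative L) (at (x + 0 *\<^sub>R v))"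
            using diff[of \<alpha> x] by (auto simp: differentiable_def)
          have "((\<lambda>t. c \<alpha> (x + t *\<^sub>R v)) has_derivative (\<lambda>t. L (0 + t *\<^sub>R v))) (at 0)"
            by (rule has_derivative_compose[where g = "c \<alpha>"]) (use L in \<open>auto intro!: derivative_eq_intros\<close>)
          moreover have "(\<lambda>t. L (0 + t *\<^sub>R v)) = (*) (L v)"
            using linear_cmul[OF has_derivative_linear[OF L]] by (auto simp: mult.commute)
          ultimately show ?thesis
            unfolding has_field_derivative_def by (intro exI[of _ "L v"]) simp
        qed
        then obtain d where d: "\<And>\<alpha>. ((\<lambda>t. c \<alpha> (x + t *\<^sub>R v)) has_real_derivative d \<alpha>) (at 0)" by metis
        have "(\<Sum>\<alpha>\<in>B. d \<alpha> * mon \<alpha> e + dmon \<alpha> e v * c \<alpha> x) = 0" for e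
        proof -
          have "((\<lambda>t. \<Sum>\<alpha>\<in>B. c \<alpha> (x + t *\<^sub>R v) * mon \<alpha> (e + t *\<^sub>R v)) has_real_derivative
             (\<Sum>\<alpha>\<in>B. d \<alpha> * mon \<alpha> (e + 0 *\<^sub>R v) + dmon \<alpha> e v * c \<alpha> (x + 0 *\<^sub>R v))) (at 0)"
            by (intro DERIV_sum DERIV_mult d has_derivative_mon)
          moreover have "((\<lambda>t. \<Sum>\<alpha>\<in>B. c \<alpha> (x + t *\<^sub>R v) * mon \<alpha> (e + t *\<^sub>R v)) has_real_derivative 0) (at 0)"
          proof -
            \<comment> \<open>The expansion over \<open>B\<close> holds only for points of
              \<open>V\<close>; as \<open>V\<close> is open, this suffices for the derivative at
              0.\<close>
            have "((\<lambda>t. x + t *\<^sub>R v) \<longlongrightarrow> x + 0 *\<^sub>R v) (nhds (0::real))"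
              by (intro tendsto_intros filterlim_ident)
            then have "\<forall>\<^sub>F t in nhds (0::real). x + t *\<^sub>R v \<in> V"
              using V(2) x by (auto dest: topological_tendstoD)
            then have "\<forall>\<^sub>F t in nhds (0::real). F (x + t *\<^sub>R v) (e + t *\<^sub>R v) = (\<Sum>\<alpha>\<in>B. c \<alpha> (x + t *\<^sub>R v) * mon \<alpha> (e + t *\<^sub>R v))"
              by eventually_elim (rule FB)
            from DERIV_cong_ev[OF refl this refl] zero show ?thesis by blast
          qed
          ultimately show ?thesis using DERIV_unique by fastforce
        qed
        then show "v $ i = 0"
          using leading_derivative_vanishes[OF B \<alpha>0 min _ i, of v "\<lambda>\<alpha> s. c \<alpha> x" "\<lambda>\<alpha>. c \<alpha> x" d] v sgn0[OF x]
          by simp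
      next
        assume zero: "\<forall>e. ((\<lambda>t. F (x + e) (e + t *\<^sub>R v)) has_real_derivative 0) (at 0)"
        \<comment> \<open>Here the first argument stays at \<open>x + eps s\<close> while
          \<open>t\<close> varies, so the coefficients contribute no derivative. Eventually this
          point lies in \<open>V\<close>, and the coefficients tend to their values at
          \<open>x\<close>.\<close>
        have lim: "(\<lambda>s. x + eps s) \<longlonglongrightarrow> x"
          using tendsto_add[OF tendsto_const[of x] eps_tendsto_0] by simp
        have "(\<lambda>s. c \<alpha> (x + eps s)) \<longlonglongrightarrow> c \<alpha> x" for \<alpha>
          using lim cont[of \<alpha>] by (auto simp: continuous_on_eq_continuous_at intro: isCont_tendsto_compose)
        moreover have "\<forall>\<^sub>F s in sequentially. (\<Sum>\<alpha>\<in>B. 0 * mon \<alpha> (eps s) + dmon \<alpha> (eps s) v * c \<alpha> (x + eps s)) = 0"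
          using topological_tendstoD[OF lim V(2) x]
        proof eventually_elim
          case (elim s)
          have "((\<lambda>t. \<Sum>\<alpha>\<in>B. c \<alpha> (x + eps s) * mon \<alpha> (eps s + t *\<^sub>R v)) has_real_derivative
             (\<Sum>\<alpha>\<in>B. 0 * mon \<alpha> (eps s + 0 *\<^sub>R v) + dmon \<alpha> (eps s) v * c \<alpha> (x + eps s))) (at 0)"
            by (intro DERIV_sum DERIV_mult has_derivative_mon DERIV_const)
          moreover have "((\<lambda>t. \<Sum>\<alpha>\<in>B. c \<alpha> (x + eps s) * mon \<alpha> (eps s + t *\<^sub>R v)) has_real_derivative 0) (at 0)"
            using zero[rule_format, of "eps s"] unfolding FB[OF elim] .
          ultimately show ?case using DERIV_unique by fastforce
        qed
        ultimately show "v $ i = 0"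
          using leading_derivative_vanishes[OF B \<alpha>0 min _ i, of v "\<lambda>\<alpha> s. c \<alpha> (x + eps s)" "\<lambda>\<alpha>. c \<alpha> x" "\<lambda>_. 0"] v sgn0[OF x]
          by simp
      qed
    qed
    have "\<sigma> \<alpha>0 \<noteq> 0" using \<alpha>0 by (simp add: B_def)
    moreover have "separates F x i \<or> (\<forall>\<^sub>F s in sequentially. sgn (F x (eps_without i s)) = \<sigma> \<alpha>0)" if "x \<in> V" for x i
      using evi[OF that, of i] sep[OF that, of i] by blast
    ultimately show ?thesis using V ev by (intro exI[of _ V] conjI exI[of _ "\<sigma> \<alpha>0"]) auto
  qed
qed

section \<open>Protocols at infinitesimal points\<close>

text \<open>The input of each party at the point \<open>(x, - x)\<close>, where
  \<open>e = 0\<close>. The gradients are taken there.\<close>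

primrec side :: "party \<Rightarrow> real ^ 'n \<Rightarrow> real ^ 'n" where
  "side First x = x"
| "side Second x = - x"

text \<open>With coordinates ordered by their primes, \<open>i\<close> is not the top coordinate of
  any vector in the common kernel of the gradients of either party.\<close>

definition detected :: "real ^ 'n \<Rightarrow> (party \<times> 'n real_mpoly) set \<Rightarrow> 'n \<Rightarrow> bool" where
  "detected x Q i \<longleftrightarrow> (\<forall>w v. (\<forall>j. p j > p i \<longrightarrow> v $ j = 0) \<longrightarrow>
     (\<forall>q. (w, q) \<in> Q \<longrightarrow> ((\<lambda>t. mpoly_eval q (($) (side w x + t *\<^sub>R v))) has_real_derivative 0) (at 0)) \<longrightarrow>
     v $ i = 0)"

lemma detected_mono: "detected x Q i \<Longrightarrow> Q \<subseteq> Q' \<Longrightarrow> detected x Q' i"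
  unfolding detected_def by blast

definition values_at :: "(party \<times> 'n real_mpoly) list \<Rightarrow> (real ^ 'n) \<times> (real ^ 'n) \<Rightarrow> real list" where
  "values_at qs z = map (\<lambda>(w, q). party_value w q z) qs"

definition test_value :: "nat real_mpoly \<Rightarrow> (party \<times> 'n real_mpoly) list \<Rightarrow> (real ^ 'n) \<times> (real ^ 'n) \<Rightarrow> real" where
  "test_value P qs z = mpoly_eval P (\<lambda>k. values_at qs z ! k)"

lemma expandable_test_value:
  assumes "mpoly_vars P \<subseteq> {..<length qs}"
  shows "expandable (\<lambda>x e. test_value P qs (x, e - x))"
  unfolding test_value_def
proof (rule expandable_mpoly_eval)
  fix k assume "k \<in> mpoly_vars P"
  with assms have "values_at qs z ! k = party_value (fst (qs ! k)) (snd (qs ! k)) z" for z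
    by (auto simp: values_at_def split_beta)
  then show "expandable (\<lambda>x e. values_at qs (x, e - x) ! k)" by (simp add: expandable_party_value)
qed

text \<open>A kernel vector of one party is used to move the input of that party alone. The values
  of the other party stay constant, and those of the moving party have derivative 0. By the chain
  rule so does the test, which is a premise in \<open>separates\<close>. The second party moves from
  \<open>- x\<close>, with the first input fixed at \<open>x + e\<close>.\<close>

lemma separates_test_value_detected:
  assumes P: "mpoly_vars P \<subseteq> {..<length qs}"
    and sep: "separates (\<lambda>x e. test_value P qs (x, e - x)) x i"
  shows "detected x (set qs) i"
  unfolding detected_def
proof (intro allI impI)
  fix w v
  assume v: "\<forall>j. p j > p i \<longrightarrow> v $ j = 0"
    and zero: "\<forall>q. (w, q) \<in> set qs \<longrightarrow> ((\<lambda>t. mpoly_eval q (($) (side w x + t *\<^sub>R v))) has_real_derivative 0) (at 0)"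
  have test: "((\<lambda>t. test_value P qs (z t)) has_real_derivative 0) (at 0)"
    if *: "\<And>w q. (w, q) \<in> set qs \<Longrightarrow> ((\<lambda>t. party_value w q (z t)) has_real_derivative 0) (at 0)" for z
    unfolding test_value_def
  proof (rule mpoly_eval_deriv_zero)
    fix k assume "k \<in> mpoly_vars P"
    with P have "k < length qs" by auto
    moreover from this have "(\<lambda>t. values_at qs (z t) ! k) = (\<lambda>t. party_value (fst (qs ! k)) (snd (qs ! k)) (z t))"
      by (auto simp: values_at_def split_beta)
    ultimately show "((\<lambda>t. values_at qs (z t) ! k) has_real_derivative 0) (at 0)" using * by simp
  qed
  show "v $ i = 0"
  proof (cases w)
    case First
    have "((\<lambda>t. test_value P qs (x + t *\<^sub>R v, e - x)) has_real_derivative 0) (at 0)" for e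
    proof (rule test)
      fix w' q assume "(w', q) \<in> set qs"
      then show "((\<lambda>t. party_value w' q (x + t *\<^sub>R v, e - x)) has_real_derivative 0) (at 0)"
        using zero First by (cases w') auto
    qed
    then have "\<forall>e. ((\<lambda>t. test_value P qs (x + t *\<^sub>R v, e + t *\<^sub>R v - (x + t *\<^sub>R v))) has_real_derivative 0) (at 0)"
      by (simp add: algebra_simps)
    then show ?thesis using sep v unfolding separates_def by blast
  next
    case Second
    have "((\<lambda>t. test_value P qs (x + e, - x + t *\<^sub>R v)) has_real_derivative 0) (at 0)" for e
    proof (rule test)
      fix w' q assume "(w', q) \<in> set qs"
      then show "((\<lambda>t. party_value w' q (x + e, - x + t *\<^sub>R v)) has_real_derivative 0) (at 0)"
        using zero Second by (cases w') auto
    qed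
    then have "\<forall>e. ((\<lambda>t. test_value P qs (x + e, e + t *\<^sub>R v - (x + e))) has_real_derivative 0) (at 0)"
      by (simp add: algebra_simps)
    then show ?thesis using sep v unfolding separates_def by blast
  qed
qed

section \<open>Gradients and the number of detected coordinates\<close>

lemma gradient_mpoly_eval:
  "\<exists>g. \<forall>v. ((\<lambda>t. mpoly_eval q (($) (x + t *\<^sub>R v))) has_real_derivative g \<bullet> v) (at 0)" for x :: "real ^ 'n"
proof -
  have "(\<lambda>x. mpoly_eval q (\<lambda>i. x $ i)) differentiable (at x)"
    by (rule expandable_differentiable[where F = "\<lambda>x _. mpoly_eval q (\<lambda>i. x $ i)" and e = 0])
      (intro expandable_mpoly_eval expandable_fst)
  then obtain L where L: "((\<lambda>x. mpoly_eval q (($) x)) has_derivative L) (at x)"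
    by (auto simp: differentiable_def)
  then have lin: "linear L" by (rule has_derivative_linear)
  \<comment> \<open>The vector \<open>adjoint L 1\<close> is the gradient, since it represents the
    functional \<open>L\<close> through the inner product.\<close>
  have "((\<lambda>t. mpoly_eval q (($) (x + t *\<^sub>R v))) has_real_derivative adjoint L 1 \<bullet> v) (at 0)" for v
  proof -
    have "((\<lambda>t. mpoly_eval q (($) (x + t *\<^sub>R v))) has_derivative (\<lambda>t. L (0 + t *\<^sub>R v))) (at 0)"
      by (rule has_derivative_compose[where g = "\<lambda>x. mpoly_eval q (($) x)"])
        (use L in \<open>auto intro!: derivative_eq_intros\<close>)
    also have "(\<lambda>t. L (0 + t *\<^sub>R v)) = (*) (adjoint L 1 \<bullet> v)"
      using adjoint_works[OF lin, of v 1] by (auto simp: linear_cmul[OF lin] inner_commute)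
    finally show ?thesis by (simp only: has_field_derivative_def)
  qed
  then show ?thesis by blast
qed

text \<open>Otherwise the gradients of party \<open>W\<close> and the unit vectors outside
  \<open>?D\<close> are fewer than \<open>CARD('n)\<close> vectors. A nonzero \<open>v\<close>
  orthogonal to all of them lies in the kernel and is supported in \<open>?D\<close>, so its top
  coordinate contradicts \<open>detected\<close>.\<close>

lemma card_detected:
  "card {i. detected x (set qs) i} \<le> length (filter (\<lambda>(w, q). w = W) qs)" (is "card ?D \<le> ?k")
proof (rule ccontr)
  assume "\<not> card ?D \<le> ?k"
  obtain g where g: "\<And>q v. ((\<lambda>t. mpoly_eval q (($) (side W x + t *\<^sub>R v))) has_real_derivative g q \<bullet> v) (at 0)"
    using gradient_mpoly_eval[of _ "side W x"] by metis
  let ?G = "(\<lambda>(w, q). g q) ` set (filter (\<lambda>(w, q). w = W) qs)"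
  let ?E = "(\<lambda>i. axis i (1::real)) ` (- ?D)"
  have "card ?G \<le> ?k" by (meson card_image_le card_length finite_set order_trans)
  moreover have "card ?E \<le> CARD('n) - card ?D"
    using card_image_le[of "- ?D" "\<lambda>i. axis i (1::real)"] by (simp add: Compl_eq_Diff_UNIV card_Diff_subset)
  moreover have "card ?D \<le> CARD('n)" by (rule card_mono) auto
  ultimately have "card (?G \<union> ?E) < CARD('n)"
    using card_Un_le[of ?G ?E] \<open>\<not> card ?D \<le> ?k\<close> by linarith
  moreover have "dim (?G \<union> ?E) \<le> card (?G \<union> ?E)" by (rule dim_le_card') simp
  ultimately obtain v where v: "v \<noteq> 0" "\<And>y. y \<in> span (?G \<union> ?E) \<Longrightarrow> orthogonal v y"
    using orthogonal_to_subspace_exists[of "?G \<union> ?E"] by auto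
  have vD: "v $ i = 0" if "i \<notin> ?D" for i
    using v(2)[OF span_base, of "axis i 1"] that by (auto simp: orthogonal_def inner_axis)
  have vG: "g q \<bullet> v = 0" if "(W, q) \<in> set qs" for q
    using v(2)[OF span_base, of "g q"] that by (force simp: orthogonal_def inner_commute)
  have "\<exists>i. v $ i \<noteq> 0" using v(1) by (auto simp: vec_eq_iff)
  then have "Max (p ` {i. v $ i \<noteq> 0}) \<in> p ` {i. v $ i \<noteq> 0}" by (intro Max_in) auto
  then obtain i where i: "v $ i \<noteq> 0" "p i = Max (p ` {i. v $ i \<noteq> 0})" by auto
  have max: "p j \<le> p i" if "v $ j \<noteq> 0" for j
    unfolding i(2) using that by (intro Max_ge) auto
  have "detected x (set qs) i" using vD[of i] i(1) by auto
  moreover have "((\<lambda>t. mpoly_eval q (($) (side W x + t *\<^sub>R v))) has_real_derivative 0) (at 0)"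
    if "(W, q) \<in> set qs" for q using g[of q v] vG[OF that] by simp
  ultimately have "v $ i = 0"
    unfolding detected_def using max by (metis not_less)
  with i(1) show False by simp
qed

text \<open>The bound holds for each party separately, and the smaller of the two counts is at most
  half of their sum.\<close>

lemma card_detected_half: "2 * card {i. detected x (set qs) i} \<le> length qs"
proof -
  have "length (filter (\<lambda>(w, q). w = First) qs) + length (filter (\<lambda>(w, q). w = Second) qs) = length qs"
  proof (induction qs)
    case (Cons a qs)
    then show ?case by (cases "fst a") (auto simp: split_beta)
  qed simp
  then show ?thesis using card_detected[of x qs First] card_detected[of x qs Second] by linarith
qed

lemma finite_sign_vectors: "finite (sign_vectors k)"
proof -
  have "sign_vectors k = {s. set s \<subseteq> {-1, 0, 1} \<and> length s = k}" by (auto simp: sign_vectors_def)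
  then show ?thesis using finite_lists_length_eq[of "{-1, 0, 1::real}" k] by simp
qed

text \<open>Induction along the branch taken at \<open>eps s\<close>. The list \<open>qs\<close>
  holds the polynomials strictly above the current vertex, and \<open>qs'\<close> collects all those
  met down to the leaf. The open set shrinks at each vertex, so that one branch serves all its
  points.\<close>

lemma run_infinitesimal:
  assumes "wf_subprotocol C (length qs)" "open U" "U \<noteq> {}"
  shows "\<exists>V\<subseteq>U. open V \<and> V \<noteq> {} \<and> (\<exists>out qs'. length qs' \<le> length qs + depth C \<and> set qs \<subseteq> set qs' \<and>
    (\<forall>x\<in>V. (\<forall>\<^sub>F s in sequentially. run C (x, eps s - x) (values_at qs (x, eps s - x)) = out) \<and>
      (\<forall>i. detected x (set qs') i \<or>
        (\<forall>\<^sub>F s in sequentially. run C (x, eps_without i s - x) (values_at qs (x, eps_without i s - x)) = out))))"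
  using assms
proof (induction C arbitrary: qs U)
  case (Leaf b)
  then show ?case by (intro exI[of _ U] conjI exI[of _ b] exI[of _ qs]) auto
next
  case (Node w q Ps ch)
  define qs1 where "qs1 = qs @ [(w, q)]"
  have vars: "mpoly_vars P \<subseteq> {..<length qs1}" if "P \<in> set Ps" for P
    using Node.prems(1) that by (auto simp: qs1_def)
  define Q where "Q P V \<longleftrightarrow> (\<exists>\<sigma>. \<forall>x\<in>V. (\<forall>\<^sub>F s in sequentially. sgn (test_value P qs1 (x, eps s - x)) = \<sigma>) \<and>
      (\<forall>i. detected x (set qs1) i \<or> (\<forall>\<^sub>F s in sequentially. sgn (test_value P qs1 (x, eps_without i s - x)) = \<sigma>)))" for P V
  have "\<exists>V\<subseteq>U. open V \<and> V \<noteq> {} \<and> (\<forall>P\<in>set Ps. Q P V)"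
  proof (rule finite_shrink)
    fix P and U :: "(real ^ 'n) set" assume P: "P \<in> set Ps" and "open U" "U \<noteq> {}"
    then show "\<exists>V\<subseteq>U. open V \<and> V \<noteq> {} \<and> Q P V"
      using expandable_sign[OF expandable_test_value[OF vars[OF P]], of U]
        separates_test_value_detected[OF vars[OF P]] unfolding Q_def by meson
  next
    show "Q P V \<Longrightarrow> W \<subseteq> V \<Longrightarrow> Q P W" for P and V W :: "(real ^ 'n) set" unfolding Q_def by blast
  qed (use Node.prems in auto)
  then obtain V1 where V1: "V1 \<subseteq> U" "open V1" "V1 \<noteq> {}" "\<forall>P\<in>set Ps. Q P V1" by blast
  then obtain \<sigma> where \<sigma>: "\<And>P x. P \<in> set Ps \<Longrightarrow> x \<in> V1 \<Longrightarrow>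
       (\<forall>\<^sub>F s in sequentially. sgn (test_value P qs1 (x, eps s - x)) = \<sigma> P)"
    "\<And>P x i. P \<in> set Ps \<Longrightarrow> x \<in> V1 \<Longrightarrow> detected x (set qs1) i \<or>
       (\<forall>\<^sub>F s in sequentially. sgn (test_value P qs1 (x, eps_without i s - x)) = \<sigma> P)"
    unfolding Q_def by metis
  \<comment> \<open>The limiting sign is attained at some \<open>s\<close>, so it is a genuine sign
    and the chosen child belongs to the tree.\<close>
  have "\<sigma> P \<in> {-1, 0, 1}" if P: "P \<in> set Ps" for P
  proof -
    obtain x where "x \<in> V1" using V1 by blast
    from eventually_happens[OF \<sigma>(1)[OF P this]] show ?thesis by (auto simp: sgn_if split: if_splits)
  qed
  then have ss: "map \<sigma> Ps \<in> sign_vectors (length Ps)" by (auto simp: sign_vectors_def)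
  have "wf_subprotocol (ch (map \<sigma> Ps)) (length qs1)" using Node.prems(1) ss by (simp add: qs1_def)
  from Node.IH[OF rangeI this V1(2,3)] obtain V out qs' where V: "V \<subseteq> V1" "open V" "V \<noteq> {}"
    and len: "length qs' \<le> length qs1 + depth (ch (map \<sigma> Ps))" and sub: "set qs1 \<subseteq> set qs'"
    and run: "\<And>x. x \<in> V \<Longrightarrow> \<forall>\<^sub>F s in sequentially. run (ch (map \<sigma> Ps)) (x, eps s - x) (values_at qs1 (x, eps s - x)) = out"
    "\<And>x i. x \<in> V \<Longrightarrow> detected x (set qs') i \<or>
        (\<forall>\<^sub>F s in sequentially. run (ch (map \<sigma> Ps)) (x, eps_without i s - x) (values_at qs1 (x, eps_without i s - x)) = out)"
    by (elim exE conjE) (rule that, (assumption | blast)+)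
  have "depth (ch (map \<sigma> Ps)) \<le> Max ((\<lambda>s. depth (ch s)) ` sign_vectors (length Ps))"
    using ss finite_sign_vectors by (intro Max_ge) auto
  then have len': "length qs' \<le> length qs + depth (Node w q Ps ch)" using len by (simp add: qs1_def)
  have step: "run (Node w q Ps ch) z (values_at qs z) = run (ch (map \<sigma> Ps)) z (values_at qs1 z)"
    if "\<forall>P\<in>set Ps. sgn (test_value P qs1 z) = \<sigma> P" for z
  proof -
    have "run (Node w q Ps ch) z (values_at qs z)
        = run (ch (map (\<lambda>P. sgn (test_value P qs1 z)) Ps)) z (values_at qs1 z)"
      by (simp add: test_value_def values_at_def qs1_def Let_def)
    also have "map (\<lambda>P. sgn (test_value P qs1 z)) Ps = map \<sigma> Ps" using that by simp
    finally show ?thesis .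
  qed
  have "\<forall>\<^sub>F s in sequentially. run (Node w q Ps ch) (x, eps s - x) (values_at qs (x, eps s - x)) = out"
    if x: "x \<in> V" for x
  proof -
    have "\<forall>\<^sub>F s in sequentially. \<forall>P\<in>set Ps. sgn (test_value P qs1 (x, eps s - x)) = \<sigma> P"
      using \<sigma>(1) x V by (intro eventually_ball_finite) auto
    then show ?thesis using run(1)[OF x] by eventually_elim (simp only: step)
  qed
  moreover have "detected x (set qs') i \<or>
      (\<forall>\<^sub>F s in sequentially. run (Node w q Ps ch) (x, eps_without i s - x) (values_at qs (x, eps_without i s - x)) = out)"
    if x: "x \<in> V" for x i
  proof (cases "detected x (set qs') i")
    case False
    \<comment> \<open>More polynomials shrink the kernel, so an index that the whole branch fails to
      detect is not detected at this vertex either.\<close>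
    then have "\<not> detected x (set qs1) i" using detected_mono sub by blast
    then have "\<forall>\<^sub>F s in sequentially. \<forall>P\<in>set Ps. sgn (test_value P qs1 (x, eps_without i s - x)) = \<sigma> P"
      using \<sigma>(2) x V by (intro eventually_ball_finite) auto
    moreover have "\<forall>\<^sub>F s in sequentially. run (ch (map \<sigma> Ps)) (x, eps_without i s - x) (values_at qs1 (x, eps_without i s - x)) = out"
      using run(2)[OF x] False by blast
    ultimately have "\<forall>\<^sub>F s in sequentially. run (Node w q Ps ch) (x, eps_without i s - x)
        (values_at qs (x, eps_without i s - x)) = out"
      by eventually_elim (simp only: step)
    then show ?thesis ..
  qed simp
  moreover have "set qs \<subseteq> set qs'" using sub by (auto simp: qs1_def)
  ultimately show ?case using V V1(1) len'
    by (intro exI[of _ V] conjI exI[of _ out] exI[of _ qs']) auto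
qed

section \<open>Averaging over the random choice\<close>

lemma sum_sum_list_swap:
  fixes f :: "'i \<Rightarrow> 'a \<Rightarrow> real"
  shows "(\<Sum>i\<in>I. \<Sum>x\<leftarrow>xs. f i x) = (\<Sum>x\<leftarrow>xs. \<Sum>i\<in>I. f i x)"
  by (induction xs) (simp_all add: sum.distrib)

text \<open>Membership changes when \<open>e $ i\<close> becomes 0, so protocols that notice this
  must have total probability above \<open>1/3\<close>, for every \<open>i\<close>. Summing over
  \<open>i\<close> compares this with the bound of half the depth on the indices noticed by a single
  protocol. The flag \<open>b\<close> allows the generic input to lie in \<open>A\<close> or outside
  it.\<close>

lemma prob_depth_lower_bound:
  assumes F: "recognizes F A"
    and A: "\<exists>V. open V \<and> V \<noteq> {} \<and> (\<forall>x\<in>V. (\<forall>\<^sub>F s in sequentially. (x, eps s - x) \<in> A \<longleftrightarrow> b) \<and>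
       (\<forall>i. \<forall>\<^sub>F s in sequentially. (x, eps_without i s - x) \<in> A \<longleftrightarrow> \<not> b))"
  shows "real (prob_depth F) > real CARD('n) / 2"
proof -
  have nonneg: "\<And>w C. (w, C) \<in> set F \<Longrightarrow> w \<ge> 0" and wf: "\<And>w C. (w, C) \<in> set F \<Longrightarrow> wf_protocol C"
    and one: "(\<Sum>(w, C)\<leftarrow>F. w) = 1"
    using F unfolding recognizes_def wf_prob_protocol_def by auto
  obtain U where U: "open U" "U \<noteq> {}" "\<And>x. x \<in> U \<Longrightarrow> \<forall>\<^sub>F s in sequentially. (x, eps s - x) \<in> A \<longleftrightarrow> b"
    "\<And>x i. x \<in> U \<Longrightarrow> \<forall>\<^sub>F s in sequentially. (x, eps_without i s - x) \<in> A \<longleftrightarrow> \<not> b"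
    using A by blast
  define Q where "Q C V \<longleftrightarrow> (\<exists>out qs'. length qs' \<le> depth C \<and>
    (\<forall>x\<in>V. (\<forall>\<^sub>F s in sequentially. accepts C (x, eps s - x) = out) \<and>
      (\<forall>i. detected x (set qs') i \<or>
        (\<forall>\<^sub>F s in sequentially. accepts C (x, eps_without i s - x) = out))))" for C V
  have "\<exists>V\<subseteq>U. open V \<and> V \<noteq> {} \<and> (\<forall>C\<in>snd ` set F. Q C V)"
  proof (rule finite_shrink)
    fix C and U :: "(real ^ 'n) set" assume "C \<in> snd ` set F" "open U" "U \<noteq> {}"
    then show "\<exists>V\<subseteq>U. open V \<and> V \<noteq> {} \<and> Q C V"
      using run_infinitesimal[of C "[]" U] wf
      unfolding Q_def wf_protocol_def accepts_def values_at_def by auto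
  next
    show "Q C V \<Longrightarrow> W \<subseteq> V \<Longrightarrow> Q C W" for C and V W :: "(real ^ 'n) set" unfolding Q_def by blast
  qed (use U in auto)
  then obtain V where V: "V \<subseteq> U" "V \<noteq> {}" "\<And>C. C \<in> snd ` set F \<Longrightarrow> Q C V" by blast
  then obtain x where x: "x \<in> V" "x \<in> U" by blast
  have "\<forall>C\<in>snd ` set F. \<exists>out D. 2 * card D \<le> depth C \<and> (\<forall>\<^sub>F s in sequentially. accepts C (x, eps s - x) = out) \<and>
      (\<forall>i. i \<in> D \<or> (\<forall>\<^sub>F s in sequentially. accepts C (x, eps_without i s - x) = out))"
  proof
    fix C assume "C \<in> snd ` set F"
    from V(3)[OF this] obtain out qs' where "length qs' \<le> depth C"
      "\<forall>\<^sub>F s in sequentially. accepts C (x, eps s - x) = out"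
      "\<forall>i. detected x (set qs') i \<or> (\<forall>\<^sub>F s in sequentially. accepts C (x, eps_without i s - x) = out)"
      unfolding Q_def using x by blast
    then show "\<exists>out D. 2 * card D \<le> depth C \<and> (\<forall>\<^sub>F s in sequentially. accepts C (x, eps s - x) = out) \<and>
      (\<forall>i. i \<in> D \<or> (\<forall>\<^sub>F s in sequentially. accepts C (x, eps_without i s - x) = out))"
      using card_detected_half[of x qs'] by (intro exI[of _ out] exI[of _ "{i. detected x (set qs') i}"]) auto
  qed
  then obtain out D where D: "\<And>C. C \<in> snd ` set F \<Longrightarrow> 2 * card (D C) \<le> depth C"
    and acc: "\<And>C. C \<in> snd ` set F \<Longrightarrow> \<forall>\<^sub>F s in sequentially. accepts C (x, eps s - x) = out C"
    "\<And>C i. C \<in> snd ` set F \<Longrightarrow> i \<notin> D C \<Longrightarrow> \<forall>\<^sub>F s in sequentially. accepts C (x, eps_without i s - x) = out C"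
    by metis
  have "\<forall>\<^sub>F s in sequentially. \<forall>C\<in>snd ` set F. accepts C (x, eps s - x) = out C"
    using acc by (intro eventually_ball_finite) auto
  moreover have "\<forall>\<^sub>F s in sequentially. \<forall>C\<in>snd ` set F. \<forall>i\<in>-D C. accepts C (x, eps_without i s - x) = out C"
    using acc by (intro eventually_ball_finite ballI) auto
  moreover have "\<forall>\<^sub>F s in sequentially. \<forall>i\<in>UNIV. (x, eps_without i s - x) \<in> A \<longleftrightarrow> \<not> b"
    using U(4)[OF x(2)] by (intro eventually_ball_finite) auto
  ultimately have "\<forall>\<^sub>F s in sequentially. ((x, eps s - x) \<in> A \<longleftrightarrow> b) \<and> (\<forall>i. (x, eps_without i s - x) \<in> A \<longleftrightarrow> \<not> b) \<and>
     (\<forall>C\<in>snd ` set F. accepts C (x, eps s - x) = out C \<and> (\<forall>i\<in>-D C. accepts C (x, eps_without i s - x) = out C))"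
    using U(3)[OF x(2)] by eventually_elim blast
  \<comment> \<open>Finitely many protocols and indices are involved, so a single \<open>s\<close>
    serves all of them.\<close>
  from eventually_happens[OF this] obtain s where s: "(x, eps s - x) \<in> A \<longleftrightarrow> b"
    "\<And>i. (x, eps_without i s - x) \<in> A \<longleftrightarrow> \<not> b"
    "\<And>C. C \<in> snd ` set F \<Longrightarrow> accepts C (x, eps s - x) = out C"
    "\<And>C i. C \<in> snd ` set F \<Longrightarrow> i \<notin> D C \<Longrightarrow> accepts C (x, eps_without i s - x) = out C" by auto
  have third: "1 / 3 < (\<Sum>(w, C)\<leftarrow>F. if i \<in> D C then w else 0)" for i
  proof -
    let ?z = "(x, eps s - x)" and ?z' = "(x, eps_without i s - x)"
    have "2 / 3 < correct_prob F A z" for z using F unfolding recognizes_def by blast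
    from this[of ?z] this[of ?z'] have "4 / 3 < correct_prob F A ?z + correct_prob F A ?z'" by linarith
    also have "\<dots> = (\<Sum>(w, C)\<leftarrow>F. (if accepts C ?z \<longleftrightarrow> ?z \<in> A then w else 0) + (if accepts C ?z' \<longleftrightarrow> ?z' \<in> A then w else 0))"
      unfolding correct_prob_def by (simp add: case_prod_unfold sum_list_addf)
    \<comment> \<open>If \<open>i \<notin> D C\<close>, the answers at both inputs agree although
      membership differs, so only one of them is correct.\<close>
    also have "\<dots> \<le> (\<Sum>(w, C)\<leftarrow>F. w + (if i \<in> D C then w else 0))"
    proof (rule sum_list_mono)
      fix wC assume wC: "wC \<in> set F"
      obtain w C where [simp]: "wC = (w, C)" by (cases wC)
      have "C \<in> snd ` set F" "w \<ge> 0" using wC nonneg by force+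
      then show "(case wC of (w, C) \<Rightarrow> (if accepts C ?z \<longleftrightarrow> ?z \<in> A then w else 0) + (if accepts C ?z' \<longleftrightarrow> ?z' \<in> A then w else 0))
        \<le> (case wC of (w, C) \<Rightarrow> w + (if i \<in> D C then w else 0))"
        using s by (cases "i \<in> D C") auto
    qed
    also have "\<dots> = (\<Sum>(w, C)\<leftarrow>F. w) + (\<Sum>(w, C)\<leftarrow>F. if i \<in> D C then w else 0)"
      by (simp add: case_prod_unfold sum_list_addf)
    finally show ?thesis using one by simp
  qed
  have "real CARD('n) / 3 = (\<Sum>i\<in>(UNIV :: 'n set). 1 / 3)" by simp
  also have "\<dots> < (\<Sum>i\<in>UNIV. \<Sum>(w, C)\<leftarrow>F. if i \<in> D C then w else 0)"
    using third by (intro sum_strict_mono) auto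
  also have "\<dots> = (\<Sum>(w, C)\<leftarrow>F. w * card (D C))"
    by (simp add: sum_sum_list_swap case_prod_unfold mult.commute flip: sum.inter_filter)
  also have "\<dots> \<le> (\<Sum>(w, C)\<leftarrow>F. w * (real (prob_depth F) / 2))"
  proof (rule sum_list_mono)
    fix wC assume wC: "wC \<in> set F"
    obtain w C where [simp]: "wC = (w, C)" by (cases wC)
    have "depth C \<le> prob_depth F"
      unfolding prob_depth_def using wC by (intro Max_ge) force+
    moreover have "2 * card (D C) \<le> depth C" using D wC by force
    ultimately have "real (card (D C)) \<le> real (prob_depth F) / 2" by linarith
    moreover have "w \<ge> 0" using nonneg[of w C] wC by simp
    ultimately have "w * real (card (D C)) \<le> w * (real (prob_depth F) / 2)" by (rule mult_left_mono)
    then show "(case wC of (w, C) \<Rightarrow> w * real (card (D C))) \<le> (case wC of (w, C) \<Rightarrow> w * (real (prob_depth F) / 2))"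
      by simp
  qed
  also have "\<dots> = real (prob_depth F) / 2"
    using one unfolding case_prod_unfold sum_list_mult_const by simp
  \<comment> \<open>This says that the depth exceeds \<open>2 n / 3\<close>, which is then weakened
    to \<open>n / 2\<close>.\<close>
  finally have "real CARD('n) / 3 < real (prob_depth F) / 2" .
  then show ?thesis by (simp add: field_simps)
qed

text \<open>The affine form defining \<open>H\<close> is expandable, so its sign is eventually
  constant on some open set. Sign 0 would make it vanish for all \<open>x\<close> in
  \<open>V\<close> and all \<open>e\<close>, which is impossible for a nonzero normal
  vector.\<close>

lemma affine_hyperplane_avoided:
  assumes H: "affine_hyperplane H" and U: "open U" "U \<noteq> {}"
  shows "\<exists>V\<subseteq>U. open V \<and> V \<noteq> {} \<and> (\<forall>x\<in>V. \<forall>\<^sub>F s in sequentially. (x, eps s - x) \<notin> H)"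
proof -
  obtain a b where a: "a \<noteq> 0" and H: "H = {z. a \<bullet> z = b}" using H unfolding affine_hyperplane_def by blast
  define F where "F x e = (\<Sum>i\<in>UNIV. fst a $ i * x $ i) + (\<Sum>i\<in>UNIV. snd a $ i * (e $ i - x $ i)) - b"
    for x e :: "real ^ 'n"
  have F: "F x e = a \<bullet> (x, e - x) - b" for x e
    by (simp add: F_def inner_prod_def inner_vec_def)
  have "expandable F"
    unfolding F_def by (intro expandable_diff expandable_add expandable_sum expandable_mult expandable_const
        expandable_fst expandable_snd)
  from expandable_sign[OF this U] obtain V \<sigma> where V: "V \<subseteq> U" "open V" "V \<noteq> {}"
    and \<sigma>: "\<sigma> = 0 \<Longrightarrow> \<forall>x\<in>V. \<forall>e. F x e = 0"
    and ev: "\<And>x. x \<in> V \<Longrightarrow> \<forall>\<^sub>F s in sequentially. sgn (F x (eps s)) = \<sigma>" by blast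
  have "\<sigma> \<noteq> 0"
  proof
    assume "\<sigma> = 0"
    then have zero: "a \<bullet> (x, e - x) = b" if "x \<in> V" for x e using \<sigma> that by (auto simp: F)
    obtain x where x: "x \<in> V" using V by blast
    \<comment> \<open>From \<open>(x, 0)\<close> a small step is made along the normal
      \<open>a\<close>: its first component must remain in \<open>V\<close>, while a suitable
      \<open>e\<close> reaches any second component.\<close>
    have "((\<lambda>t. x + t *\<^sub>R fst a) \<longlongrightarrow> x + 0 *\<^sub>R fst a) (at_right (0::real))"
      by (intro tendsto_intros)
    then have "\<forall>\<^sub>F t in at_right (0::real). x + t *\<^sub>R fst a \<in> V"
      using V(2) x by (auto dest: topological_tendstoD)
    then have "\<forall>\<^sub>F t in at_right (0::real). x + t *\<^sub>R fst a \<in> V \<and> t > 0"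
      by (intro eventually_conj eventually_at_right_less)
    from eventually_happens[OF this] obtain t where t: "x + t *\<^sub>R fst a \<in> V" "t > 0" by auto
    have "a \<bullet> (x + t *\<^sub>R fst a, t *\<^sub>R snd a) = b"
      using zero[OF t(1), of "x + t *\<^sub>R fst a + t *\<^sub>R snd a"] by simp
    moreover have "a \<bullet> (x, 0) = b" using zero[OF x, of x] by simp
    moreover have "(x + t *\<^sub>R fst a, t *\<^sub>R snd a) = (x, 0) + t *\<^sub>R a" by (cases a) simp
    ultimately have "t * (a \<bullet> a) = 0" by (simp add: inner_add_right)
    with t(2) a show False by simp
  qed
  have "\<forall>\<^sub>F s in sequentially. (x, eps s - x) \<notin> H" if "x \<in> V" for x
    using ev[OF that] by eventually_elim (use \<open>\<sigma> \<noteq> 0\<close> in \<open>auto simp: H F\<close>)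
  then show ?thesis using V by blast
qed

end

text \<open>The infimum over a nonempty set is attained because \<open>enat\<close> is well-ordered,
  so the strict inequality survives; over the empty set it is infinite.\<close>

lemma prob_comm_complexity_greater:
  assumes "\<And>F. recognizes F A \<Longrightarrow> real (prob_depth F) > r"
  shows "ereal_of_enat (prob_comm_complexity A) > ereal r"
proof (cases "{F. recognizes F A} = {}")
  case True
  then show ?thesis by (simp add: prob_comm_complexity_def top_enat_def)
next
  case False
  then obtain F where "recognizes F A" by blast
  then have "enat (prob_depth F) \<in> (\<lambda>F. enat (prob_depth F)) ` {F. recognizes F A}" by simp
  then have "prob_comm_complexity A \<in> (\<lambda>F. enat (prob_depth F)) ` {F. recognizes F A}"
    unfolding prob_comm_complexity_def by (rule wellorder_InfI)
  then show ?thesis using assms by auto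
qed

lemma exists_prime_weights: "\<exists>p :: 'n::finite \<Rightarrow> nat. prime_weights p"
proof -
  obtain B where B: "B \<subseteq> {p::nat. prime p}" "finite B" "card B = CARD('n)"
    using infinite_arbitrarily_large[OF primes_infinite, of "CARD('n)"] by blast
  then obtain p where "bij_betw p (UNIV :: 'n set) B"
    using finite_same_card_bij[of "UNIV :: 'n set" B] by auto
  then show ?thesis using B by (intro exI[of _ p]) (auto simp: prime_weights_def bij_betw_def)
qed

theorem theorem2:
  fixes S R :: "((real ^ 'n::finite) \<times> (real ^ 'n)) set"
    and \<H> :: "((real ^ 'n) \<times> (real ^ 'n)) set set"
  assumes S: "S = {(x, y). \<forall>i. x $ i + y $ i > 0}"
    and fin: "finite \<H>"
    and hyp: "\<forall>H\<in>\<H>. affine_hyperplane H"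
    and mem: "\<forall>i. {(x, y). x $ i + y $ i = 0} \<in> \<H>"
    and R: "R = \<Union>\<H>"
  shows "ereal_of_enat (prob_comm_complexity S) > ereal (real CARD('n) / 2) \<and>
         ereal_of_enat (prob_comm_complexity R) > ereal (real CARD('n) / 2)"
proof -
  obtain p :: "'n \<Rightarrow> nat" where "prime_weights p" using exists_prime_weights by blast
  then interpret prime_weights p .
  have "(x, eps s - x) \<in> S" for x s by (simp add: S eps_def)
  moreover have "(x, eps_without i s - x) \<notin> S" for x i s
    by (auto simp: S eps_without_def intro!: exI[of _ i])
  ultimately have "real (prob_depth F) > real CARD('n) / 2" if "recognizes F S" for F
    by (intro prob_depth_lower_bound[OF that, of True] exI[of _ UNIV]) auto
  moreover have "real (prob_depth F) > real CARD('n) / 2" if "recognizes F R" for F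
  proof (rule prob_depth_lower_bound[OF that, of False])
    \<comment> \<open>For \<open>R\<close> the roles are reversed: the generic input must avoid all
      hyperplanes at once, and setting \<open>e $ i\<close> to 0 places it on one of them.\<close>
    have "\<exists>V\<subseteq>UNIV. open V \<and> V \<noteq> {} \<and> (\<forall>H\<in>\<H>. \<forall>x\<in>V. \<forall>\<^sub>F s in sequentially. (x, eps s - x) \<notin> H)"
      using affine_hyperplane_avoided hyp by (intro finite_shrink[OF fin]) (blast | simp)+
    then obtain V where V: "open V" "V \<noteq> {}" "\<And>x H. H \<in> \<H> \<Longrightarrow> x \<in> V \<Longrightarrow> \<forall>\<^sub>F s in sequentially. (x, eps s - x) \<notin> H"
      by blast
    have "\<forall>\<^sub>F s in sequentially. (x, eps s - x) \<notin> R" if "x \<in> V" for x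
      using eventually_ball_finite[OF fin, of "\<lambda>s H. (x, eps s - x) \<notin> H" sequentially] V(3)[OF _ that]
      by (simp add: R)
    moreover have "(x, eps_without i s - x) \<in> R" for x i s
      unfolding R using mem by (intro UnionI[of "{(x, y). x $ i + y $ i = 0}"]) (auto simp: eps_without_def)
    ultimately show "\<exists>V. open V \<and> V \<noteq> {} \<and> (\<forall>x\<in>V. (\<forall>\<^sub>F s in sequentially. ((x, eps s - x) \<in> R) = False) \<and>
       (\<forall>i. \<forall>\<^sub>F s in sequentially. ((x, eps_without i s - x) \<in> R) = (\<not> False)))"
      using V by (intro exI[of _ V]) auto
  qed
  ultimately show ?thesis using prob_comm_complexity_greater by blast
qed

end
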